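(* For every positive integer $k$, $RR(\mathcal{E}(k,1)) = 4$ if $k \leq 3$, and $RR(\mathcal{E}(k,1)) = 5$ if $k \geq 4$.
   Context: For a positive integer $k$ and an integer $j > -k$, $\mathcal{E}(k,j)$ denotes the equation $x+y+kz=(k+j)w$. A $2$-coloring of $[1,N]=\{1,2,\dots,N\}$ is a map $\chi:[1,N]\to\{0,1\}$; a solution $(x,y,z,w)$ with $x,y,z,w\in[1,N]$ (not necessarily distinct) is monochromatic if $\chi(x)=\chi(y)=\chi(z)=\chi(w)$. For an equation $\mathcal{E}$, $RR(\mathcal{E})$ denotes the minimum positive integer $N$ such that every $2$-coloring of $[1,N]$ admits a monochromatic solution to $\mathcal{E}$ in $[1,N]$. *)

theory Defs
  imports "HOL-Library.FuncSet" "HOL-Library.Extended_Nat"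
begin

type_synonym equation = "nat \<Rightarrow> nat \<Rightarrow> nat \<Rightarrow> nat \<Rightarrow> bool"

text \<open>Only used for \<open>k > 0\<close> and \<open>j > - k\<close>. The coefficient \<open>k + j\<close> is formed in the
  integers, because \<open>j\<close> may be negative.\<close>

definition eqE :: "nat \<Rightarrow> int \<Rightarrow> equation" where
  "eqE k j x y z w \<longleftrightarrow> int x + int y + int k * int z = (int k + j) * int w"

definition two_colorings :: "nat \<Rightarrow> (nat \<Rightarrow> nat) set" where
  "two_colorings N = {1..N} \<rightarrow> {0, 1}"

definition has_mono_solution :: "equation \<Rightarrow> nat \<Rightarrow> (nat \<Rightarrow> nat) \<Rightarrow> bool" where
  "has_mono_solution E N \<chi> \<longleftrightarrow>
     (\<exists>x\<in>{1..N}. \<exists>y\<in>{1..N}. \<exists>z\<in>{1..N}. \<exists>w\<in>{1..N}.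
        E x y z w \<and> \<chi> x = \<chi> y \<and> \<chi> y = \<chi> z \<and> \<chi> z = \<chi> w)"

text \<open>If every \<open>N\<close> has a 2-coloring without monochromatic solution, then \<open>RR E = \<infinity>\<close>.
  A finite value is therefore attained, and is the minimum.\<close>

definition RR :: "equation \<Rightarrow> enat" where
  "RR E = (INF N \<in> {N. 0 < N \<and> (\<forall>\<chi>\<in>two_colorings N. has_mono_solution E N \<chi>)}. enat N)"

end

theory Submission
  imports Defs
begin

text \<open>
  With \<open>z = w\<close> the equation \<open>x + y + k z = (k + 1) w\<close> becomes Schur's equation \<open>x + y = w\<close>,
  whatever \<open>k\<close> is. Schur triples force the colouring \<open>{1, 4} | {2, 3}\<close> on \<open>[1, 4]\<close> and leave no
  colour for \<open>5\<close>. On \<open>{2, 3}\<close> the choice \<open>w = 3\<close>, \<open>z = 2\<close> gives \<open>x + y = k + 3\<close>, which is solvable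
  exactly when \<open>k \<le> 3\<close>.
\<close>

lemma RR_le:
  assumes "0 < N" "\<And>\<chi>. \<chi> \<in> two_colorings N \<Longrightarrow> has_mono_solution E N \<chi>"
  shows "RR E \<le> enat N"
  unfolding RR_def using assms by (intro INF_lower) auto

lemma has_mono_solution_mono:
  "has_mono_solution E N \<chi> \<Longrightarrow> N \<le> M \<Longrightarrow> has_mono_solution E M \<chi>"
  unfolding has_mono_solution_def by (meson atLeastAtMost_iff le_trans)

text \<open>A good colouring of \<open>[1, M]\<close> restricts to a good colouring of every shorter
  \<open>[1, N]\<close>, so each \<open>N\<close> in the infimum exceeds \<open>M\<close>.\<close>

lemma RR_ge:
  assumes \<chi>: "\<chi> \<in> two_colorings M" and "\<not> has_mono_solution E M \<chi>"
  shows "enat (Suc M) \<le> RR E"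
  unfolding RR_def
proof (rule INF_greatest)
  fix N assume N: "N \<in> {N. 0 < N \<and> (\<forall>\<chi>\<in>two_colorings N. has_mono_solution E N \<chi>)}"
  have "\<not> N \<le> M"
  proof
    assume "N \<le> M"
    then have "\<chi> \<in> two_colorings N" using \<chi> by (auto simp: two_colorings_def Pi_iff simp del: One_nat_def)
    with N \<open>N \<le> M\<close> assms(2) show False by (blast intro: has_mono_solution_mono)
  qed
  then show "enat (Suc M) \<le> enat N" by simp
qed

lemma eqE_1_iff: "eqE k 1 x y z w \<longleftrightarrow> x + y + k * z = w + k * w"
proof -
  have "eqE k 1 x y z w \<longleftrightarrow> int (x + y + k * z) = int (w + k * w)"
    by (simp add: eqE_def algebra_simps)
  then show ?thesis by (simp only: of_nat_eq_iff)
qed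

lemma mono_schur_triple:
  assumes "\<not> has_mono_solution (eqE k 1) N \<chi>" "1 \<le> x" "1 \<le> y" "x + y \<le> N"
  shows "\<not> (\<chi> x = \<chi> y \<and> \<chi> y = \<chi> (x + y))"
proof
  assume "\<chi> x = \<chi> y \<and> \<chi> y = \<chi> (x + y)"
  moreover have "eqE k 1 x y (x + y) (x + y)" by (simp add: eqE_1_iff)
  ultimately have "has_mono_solution (eqE k 1) N \<chi>"
    unfolding has_mono_solution_def using assms(2-4)
    by (intro bexI[of _ x] bexI[of _ y] bexI[of _ "x + y"]) auto
  with assms(1) show False by simp
qed

text \<open>The sums 1 + 1 = 2, 2 + 2 = 4 and 1 + 3 = 4, taken in this order, fix the colours of 2,
  4 and 3 relative to that of 1.\<close>

lemma schur_coloring_4: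
  assumes \<chi>: "\<chi> \<in> two_colorings N" and no: "\<not> has_mono_solution (eqE k 1) N \<chi>" and "4 \<le> N"
  shows "\<chi> 1 \<noteq> \<chi> 2" "\<chi> 3 = \<chi> 2" "\<chi> 4 = \<chi> 1"
proof -
  have two: "\<chi> i = 0 \<or> \<chi> i = 1" if "1 \<le> i" "i \<le> 4" for i
    using \<chi> that \<open>4 \<le> N\<close> by (auto simp: two_colorings_def Pi_iff)
  note schur = mono_schur_triple[OF no]
  show 12: "\<chi> 1 \<noteq> \<chi> 2" using schur[of 1 1] \<open>4 \<le> N\<close> by (auto simp: numeral_2_eq_2)
  have "\<chi> 2 \<noteq> \<chi> 4" using schur[of 2 2] \<open>4 \<le> N\<close> by auto
  then show 41: "\<chi> 4 = \<chi> 1" using 12 two[of 1] two[of 2] two[of 4] by auto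
  have "\<chi> 1 \<noteq> \<chi> 3" using schur[of 1 3] 41 \<open>4 \<le> N\<close> by auto
  then show "\<chi> 3 = \<chi> 2" using 12 two[of 1] two[of 2] two[of 3] by auto
qed

lemma RR_eqE_1_le_5: "RR (eqE k 1) \<le> 5"
proof -
  have "has_mono_solution (eqE k 1) 5 \<chi>" if \<chi>: "\<chi> \<in> two_colorings 5" for \<chi>
  proof (rule ccontr)
    assume no: "\<not> ?thesis"
    note c = schur_coloring_4[OF \<chi> no]
    \<comment> \<open>The sums 1 + 4 and 2 + 3 deny 5 the colours of 1 and of 2, and these are both
      colours.\<close>
    have "\<chi> 5 \<noteq> \<chi> 1" using mono_schur_triple[OF no, of 1 4] c by auto
    moreover have "\<chi> 5 \<noteq> \<chi> 2" using mono_schur_triple[OF no, of 2 3] c by auto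
    moreover have "\<chi> i = 0 \<or> \<chi> i = 1" if "1 \<le> i" "i \<le> 5" for i
      using \<chi> that by (auto simp: two_colorings_def Pi_iff)
    from this[of 1] this[of 2] this[of 5] have "\<chi> 5 = \<chi> 1 \<or> \<chi> 5 = \<chi> 2" using c by auto
    ultimately show False by blast
  qed
  then have "RR (eqE k 1) \<le> enat 5" by (intro RR_le) auto
  then show ?thesis by (simp add: numeral_eq_enat)
qed

lemma RR_eqE_1_le_4:
  assumes "0 < k" "k \<le> 3"
  shows "RR (eqE k 1) \<le> 4"
proof -
  have "has_mono_solution (eqE k 1) 4 \<chi>" if \<chi>: "\<chi> \<in> two_colorings 4" for \<chi>
  proof (rule ccontr)
    assume no: "\<not> ?thesis"
    have 32: "\<chi> 3 = \<chi> 2" using schur_coloring_4[OF \<chi> no] by simp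
    \<comment> \<open>Sums of two elements of \<open>{2, 3}\<close> are exactly 4, 5 and 6.\<close>
    obtain x y where xy: "x \<in> {2, 3}" "y \<in> {2, 3}" "x + y = k + 3"
    proof -
      consider "k = 1" | "k = 2" | "k = 3" using assms by linarith
      then show ?thesis by cases (use that[of 2 2] that[of 2 3] that[of 3 3] in auto)
    qed
    then have "eqE k 1 x y 2 3" by (simp add: eqE_1_iff)
    then have "has_mono_solution (eqE k 1) 4 \<chi>"
      unfolding has_mono_solution_def using xy 32
      by (intro bexI[of _ x] bexI[of _ y] bexI[of _ 2] bexI[of _ 3]) auto
    with no show False by simp
  qed
  then have "RR (eqE k 1) \<le> enat 4" by (intro RR_le) auto
  then show ?thesis by (simp add: numeral_eq_enat)
qed

lemma RR_eqE_1_ge_4: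
  assumes "0 < k"
  shows "4 \<le> RR (eqE k 1)"
proof -
  define \<chi> :: "nat \<Rightarrow> nat" where "\<chi> n = (if n = 2 then 1 else 0)" for n
  have I: "{1..3} = {1, 2, 3::nat}" by auto
  have "\<chi> \<in> two_colorings 3" by (auto simp: two_colorings_def \<chi>_def)
  \<comment> \<open>On \<open>{1, 3}\<close> the two sides have the parities of \<open>k\<close> and
    \<open>k + 1\<close>; on \<open>{2}\<close> they are \<open>4 + 2 * k\<close> and
    \<open>2 + 2 * k\<close>.\<close>
  moreover have "\<not> has_mono_solution (eqE k 1) 3 \<chi>"
    unfolding has_mono_solution_def eqE_1_iff I using assms by (simp add: \<chi>_def) presburger
  ultimately have "enat (Suc 3) \<le> RR (eqE k 1)" by (rule RR_ge)
  then show ?thesis by (simp add: numeral_eq_enat)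
qed

lemma RR_eqE_1_ge_5:
  assumes "4 \<le> k"
  shows "5 \<le> RR (eqE k 1)"
proof -
  define \<chi> :: "nat \<Rightarrow> nat" where "\<chi> n = (if n \<in> {2, 3} then 1 else 0)" for n
  have I: "{1..4} = {1, 2, 3, 4::nat}" by auto
  have "\<chi> \<in> two_colorings 4" by (auto simp: two_colorings_def \<chi>_def)
  \<comment> \<open>Neither class contains a Schur triple, so \<open>z \<noteq> w\<close>. If
    \<open>w < z\<close>, the left side is too large. If \<open>z < w\<close>, then
    \<open>x + y\<close> is \<open>k + 3 \<ge> 7\<close> on \<open>{2, 3}\<close> or
    \<open>3 * k + 4 \<ge> 16\<close> on \<open>{1, 4}\<close>, beyond the maxima 6 and 8.\<close>
  moreover have "\<not> has_mono_solution (eqE k 1) 4 \<chi>"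
    unfolding has_mono_solution_def eqE_1_iff I using assms by (simp add: \<chi>_def)
  ultimately have "enat (Suc 4) \<le> RR (eqE k 1)" by (rule RR_ge)
  then show ?thesis by (simp add: numeral_eq_enat)
qed

theorem theorem4:
  fixes k :: nat
  assumes "0 < k"
  shows "(k \<le> 3 \<longrightarrow> RR (eqE k 1) = 4) \<and> (4 \<le> k \<longrightarrow> RR (eqE k 1) = 5)"
  using assms RR_eqE_1_le_4 RR_eqE_1_ge_4 RR_eqE_1_le_5 RR_eqE_1_ge_5
  by (simp add: order_antisym)

end
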